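(* If a graph $G$ is bipartite and consists of $k$ components, then $G$ is critically $k$-uniform.
   Context: $[k]=\{1,\dots,k\}$ and $\chi(G)$ is the chromatic number of a graph $G=(V,E)$. For a proper vertex coloring $c:V\to[\chi(G)]$, a determining set for $(G,c)$ is a set $S\subseteq V$ such that for every proper vertex coloring $c':V\to[\chi(G)]$ of $G$, if $c'|_S=c|_S$ then $c'=c$ on all of $V$. A critical set for $(G,c)$ is a determining set for $(G,c)$ that is minimal under inclusion. $G$ is critically $k$-uniform if every critical set $S\subset V$ (for any proper coloring $c:V\to[\chi(G)]$) satisfies $|S|=k$. Components are connected components.
   Formalization: The graph is additionally assumed to have at least one edge unless it has no vertices; for a nonempty edgeless graph the claim is false, since its chromatic number is 1 and its only critical set is empty while k ≥ 1. *)

theory Defs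
  imports "Graph_Theory.Digraph_Component"
begin

text \<open>
  Finite simple undirected graphs are the finite symmetric digraphs without loops and parallel
  arcs of the locale \<^locale>\<open>graph\<close>: an undirected edge is a pair of opposite arcs, and for
  symmetric digraphs the strongly connected components are the connected components.
\<close>

text \<open>
  A map from the vertex set is represented by a total function whose values outside
  the vertex set are irrelevant; equality of colorings is therefore stated on the vertices only.
\<close>

definition proper_coloring :: "('a, 'b) pre_digraph \<Rightarrow> nat \<Rightarrow> ('a \<Rightarrow> nat) \<Rightarrow> bool" where
  "proper_coloring G q c \<longleftrightarrow>
     c \<in> verts G \<rightarrow> {1..q} \<and> (\<forall>u v. u \<rightarrow>\<^bsub>G\<^esub> v \<longrightarrow> c u \<noteq> c v)"

definition chromatic_number :: "('a, 'b) pre_digraph \<Rightarrow> nat" where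
  "chromatic_number G = (LEAST q. \<exists>c. proper_coloring G q c)"

definition determining_set :: "('a, 'b) pre_digraph \<Rightarrow> ('a \<Rightarrow> nat) \<Rightarrow> 'a set \<Rightarrow> bool" where
  "determining_set G c S \<longleftrightarrow> S \<subseteq> verts G \<and>
     (\<forall>c'. proper_coloring G (chromatic_number G) c' \<and> (\<forall>v\<in>S. c' v = c v)
        \<longrightarrow> (\<forall>v\<in>verts G. c' v = c v))"

definition critical_set :: "('a, 'b) pre_digraph \<Rightarrow> ('a \<Rightarrow> nat) \<Rightarrow> 'a set \<Rightarrow> bool" where
  "critical_set G c S \<longleftrightarrow>
     determining_set G c S \<and> (\<forall>T. T \<subset> S \<longrightarrow> \<not> determining_set G c T)"

definition critically_uniform :: "nat \<Rightarrow> ('a, 'b) pre_digraph \<Rightarrow> bool" where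
  "critically_uniform k G \<longleftrightarrow>
     (\<forall>c S. proper_coloring G (chromatic_number G) c \<and> critical_set G c S \<longrightarrow> card S = k)"

text \<open>
  Edgeless graphs are bipartite in this sense, but a nonempty one has chromatic number 1 instead
  of 2; its only critical set is empty, however many components it has.
\<close>

definition bipartite :: "('a, 'b) pre_digraph \<Rightarrow> bool" where
  "bipartite G \<longleftrightarrow>
     (\<exists>A B. A \<union> B = verts G \<and> A \<inter> B = {} \<and>
        (\<forall>u v. u \<rightarrow>\<^bsub>G\<^esub> v \<longrightarrow> u \<in> A \<and> v \<in> B \<or> u \<in> B \<and> v \<in> A))"

end

theory Submission
  imports Defs
begin

text \<open>
  A bipartite graph with at least one arc has chromatic number 2, and a proper 2-coloring of a
  component is known as soon as one of its values is known, whereas exchanging the two colors on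
  a single component gives a different proper coloring. So the determining sets are the sets of
  vertices meeting every component, and the minimal ones contain exactly one vertex of each.
\<close>

text \<open>The two sides of the bipartition serve as color classes. The arc gives the lower bound,
  since its ends need distinct colors in \<open>{1..q}\<close>.\<close>

lemma chromatic_number_bipartite:
  assumes "bipartite G" "arcs G \<noteq> {}" "wf_digraph G"
  shows "chromatic_number G = 2"
  unfolding chromatic_number_def
proof (rule Least_equality)
  obtain A B where AB: "A \<union> B = verts G" "A \<inter> B = {}"
    "\<And>u v. u \<rightarrow>\<^bsub>G\<^esub> v \<Longrightarrow> u \<in> A \<and> v \<in> B \<or> u \<in> B \<and> v \<in> A"
    using assms(1) unfolding bipartite_def by blast
  have "proper_coloring G 2 (\<lambda>v. if v \<in> A then 1 else 2)"
    unfolding proper_coloring_def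
  proof (intro conjI allI impI)
    show "(if u \<in> A then 1 else 2) \<noteq> (if v \<in> A then 1 else 2 :: nat)" if "u \<rightarrow>\<^bsub>G\<^esub> v" for u v
      using AB(2) AB(3)[OF that] by auto
  qed auto
  then show "\<exists>c. proper_coloring G 2 c"
    by blast
next
  fix q
  assume "\<exists>c. proper_coloring G q c"
  then obtain c where c: "proper_coloring G q c" ..
  obtain e where e: "e \<in> arcs G"
    using assms(2) by blast
  then have dom: "tail G e \<rightarrow>\<^bsub>G\<^esub> head G e"
    by (auto simp: arcs_ends_conv)
  then have "c (tail G e) \<noteq> c (head G e)"
    using c unfolding proper_coloring_def by blast
  moreover have "c (tail G e) \<in> {1..q}" "c (head G e) \<in> {1..q}"
    using c wf_digraph.adj_in_verts[OF assms(3) dom] unfolding proper_coloring_def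
    by (auto dest: funcset_mem)
  ultimately show "2 \<le> q"
    by auto
qed

text \<open>With only two colors, the color at one end of an arc forces the color at the other, so
  agreement spreads along a path.\<close>

lemma (in wf_digraph) proper_2_coloring_eq_on_reachable:
  assumes "proper_coloring G 2 c" "proper_coloring G 2 c'"
    and "u \<rightarrow>\<^sup>* v" "c' u = c u"
  shows "c' v = c v"
  using assms(3,4)
proof (induction rule: reachable_induct)
  case (step x y)
  have "x \<in> verts G" "y \<in> verts G"
    using step.hyps adj_in_verts by blast+
  then have "c x \<in> {1..2}" "c y \<in> {1..2}" "c' x \<in> {1..2}" "c' y \<in> {1..2}"
    "c x \<noteq> c y" "c' x \<noteq> c' y"
    using assms(1,2) step.hyps unfolding proper_coloring_def by blast+
  then show ?case
    using step by auto
qed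

text \<open>The map \<open>3 - c v\<close> exchanges 1 and 2. By \<open>closed\<close>, no arc
  leaves or enters \<open>T\<close>, so the ends of an arc are either both recolored or both
  kept.\<close>

lemma proper_2_coloring_swap:
  assumes "wf_digraph G" "proper_coloring G 2 c"
    and closed: "\<And>u v. u \<rightarrow>\<^bsub>G\<^esub> v \<Longrightarrow> u \<in> T \<longleftrightarrow> v \<in> T"
  shows "proper_coloring G 2 (\<lambda>v. if v \<in> T then 3 - c v else c v)"
proof -
  have range: "1 \<le> c v" "c v \<le> 2" if "v \<in> verts G" for v
    using assms(2) that unfolding proper_coloring_def by (auto dest: funcset_mem)
  have "3 - c u \<noteq> 3 - c v" if "u \<rightarrow>\<^bsub>G\<^esub> v" for u v
  proof -
    have "c u \<noteq> c v"
      using assms(2) that unfolding proper_coloring_def by blast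
    then show ?thesis
      using range[of u] range[of v] wf_digraph.adj_in_verts[OF assms(1) that] by linarith
  qed
  moreover have "3 - c v \<in> {1..2}" if "v \<in> verts G" for v
    using range[OF that] by auto
  ultimately show ?thesis
    using assms(2) closed unfolding proper_coloring_def by auto
qed

text \<open>This removes colorings from the problem: the right-hand side does not mention
  \<open>c\<close>, so minimality becomes a question about sets and components.\<close>

lemma (in sym_digraph) determining_set_iff_meets_components:
  assumes "chromatic_number G = 2" "proper_coloring G 2 c"
  shows "determining_set G c S \<longleftrightarrow> S \<subseteq> verts G \<and> (\<forall>u\<in>verts G. S \<inter> scc_of u \<noteq> {})"
proof
  assume det: "determining_set G c S"
  have "S \<inter> scc_of u \<noteq> {}" if u: "u \<in> verts G" for u
  proof
    assume disj: "S \<inter> scc_of u = {}"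
    let ?c' = "\<lambda>v. if v \<in> scc_of u then 3 - c v else c v"
    have "x \<in> scc_of u \<longleftrightarrow> y \<in> scc_of u" if "x \<rightarrow>\<^bsub>G\<^esub> y" for x y
    proof -
      \<comment> \<open>By symmetry, a single arc already makes its ends mutually reachable.\<close>
      have "x \<in> scc_of y"
        using that by (intro scc_ofI_reachable) auto
      then have "scc_of x = scc_of y"
        by (rule scc_of_eq)
      moreover have "w \<in> scc_of u \<longleftrightarrow> u \<in> scc_of w" for w
        unfolding scc_of_def by blast
      ultimately show ?thesis
        by simp
    qed
    then have "proper_coloring G 2 ?c'"
      using proper_2_coloring_swap[OF wf_digraph assms(2)] by blast
    moreover have "\<forall>v\<in>S. ?c' v = c v"
      using disj by auto
    ultimately have "?c' u = c u"
      using det u unfolding determining_set_def assms(1) by (elim conjE allE[of _ ?c']) blast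
    then have "3 - c u = c u"
      using in_scc_of_self[OF u] by simp
    \<comment> \<open>3 is odd, and for values above 3 the truncated difference is 0.\<close>
    then show False
      by presburger
  qed
  then show "S \<subseteq> verts G \<and> (\<forall>u\<in>verts G. S \<inter> scc_of u \<noteq> {})"
    using det unfolding determining_set_def by blast
next
  assume S: "S \<subseteq> verts G \<and> (\<forall>u\<in>verts G. S \<inter> scc_of u \<noteq> {})"
  show "determining_set G c S"
    unfolding determining_set_def assms(1)
  proof (intro conjI allI impI ballI)
    fix c' v
    assume c': "proper_coloring G 2 c' \<and> (\<forall>v\<in>S. c' v = c v)" and "v \<in> verts G"
    then obtain s where "s \<in> S" "s \<in> scc_of v"
      using S by blast
    then show "c' v = c v"
      using proper_2_coloring_eq_on_reachable[OF assms(2)] c' unfolding scc_of_def by blast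
  qed (use S in blast)
qed

text \<open>\<open>scc_of\<close> maps \<open>S\<close> bijectively onto \<open>sccs_verts\<close>:
  injectivity comes from minimality, surjectivity from meeting every component.\<close>

lemma (in sym_digraph) critical_set_card:
  assumes "chromatic_number G = 2" "proper_coloring G 2 c" "critical_set G c S"
  shows "card S = card sccs"
proof -
  note iff = determining_set_iff_meets_components[OF assms(1,2)]
  have S: "S \<subseteq> verts G" and meets: "\<And>u. u \<in> verts G \<Longrightarrow> S \<inter> scc_of u \<noteq> {}"
    using assms(3) unfolding critical_set_def iff by blast+
  have "inj_on scc_of S"
  proof (rule inj_onI, rule ccontr)
    fix u v
    assume uv: "u \<in> S" "v \<in> S" "scc_of u = scc_of v" "u \<noteq> v"
    \<comment> \<open>In the component of \<open>v\<close>, the vertex \<open>u\<close> takes over,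
      so \<open>v\<close> could be dropped, against minimality.\<close>
    have "(S - {v}) \<inter> scc_of w \<noteq> {}" if w: "w \<in> verts G" for w
    proof (cases "v \<in> scc_of w")
      case True
      then have "u \<in> scc_of w"
        using uv S scc_of_eq in_scc_of_self by blast
      then show ?thesis
        using uv by blast
    next
      case False
      then show ?thesis
        using meets[OF w] by blast
    qed
    then have "determining_set G c (S - {v})"
      using S unfolding iff by blast
    then show False
      using assms(3) uv unfolding critical_set_def by blast
  qed
  moreover have "scc_of ` S = sccs_verts"
  proof
    show "scc_of ` S \<subseteq> sccs_verts"
      using S scc_of_in_sccs_verts by blast
    show "sccs_verts \<subseteq> scc_of ` S"
      unfolding sccs_verts_conv_scc_of
    proof (rule image_subsetI)
      fix u
      assume "u \<in> verts G"
      then obtain s where "s \<in> S" "s \<in> scc_of u"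
        using meets by blast
      then show "scc_of u \<in> scc_of ` S"
        using scc_of_eq by blast
    qed
  qed
  ultimately show ?thesis
    using card_image[of scc_of S] card_sccs_verts by simp
qed

theorem corollary2:
  fixes G :: "('a, 'b) pre_digraph" and k :: nat
  assumes "graph G"
    and "bipartite G"
    and "verts G \<noteq> {} \<Longrightarrow> arcs G \<noteq> {}"
    and "card (pre_digraph.sccs G) = k"
  shows "critically_uniform k G"
proof -
  interpret graph G by fact
  show ?thesis
  proof (cases "verts G = {}")
    case True
    \<comment> \<open>The empty graph has chromatic number 0, so the two-color argument does not
      cover it. It has no components, and its only set of vertices is empty.\<close>
    then have "k = 0"
      using assms(4) card_sccs_verts sccs_verts_conv_scc_of by simp
    then show ?thesis
      using True
      unfolding critically_uniform_def critical_set_def determining_set_def by auto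
  next
    case False
    then have "chromatic_number G = 2"
      using chromatic_number_bipartite assms(2,3) wf_digraph by blast
    then show ?thesis
      using critical_set_card assms(4) unfolding critically_uniform_def by auto
  qed
qed

end
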